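(* Let $A$ be an infinite dimensional simple separable unital C*-algebra, and let $\alpha \colon G \to \mathrm{Aut}(A)$ be an action of a finite group $G$ on $A$. Then $\alpha$ has the tracial Rokhlin property if and only if for every finite set $F \subset A$, every $\varepsilon > 0$, and every positive element $x \in A$ with $\|x\| = 1$, there are mutually orthogonal projections $e_g \in A$ for $g \in G$ such that: (1) $\alpha_g(e_h) = e_{gh}$ for all $g, h \in G$. (2) $\|e_g a - a e_g\| < \varepsilon$ for all $g \in G$ and all $a \in F$. (3) With $e = \sum_{g \in G} e_g$, the projection $1 - e$ is Murray-von Neumann equivalent to a projection in the hereditary subalgebra of $A$ generated by $x$. (4) With $e$ as in (3), we have $\|e x e\| > 1 - \varepsilon$.
   Context: Tracial Rokhlin property: an action $\alpha \colon G \to \mathrm{Aut}(A)$ of a finite group $G$ on an infinite dimensional simple separable unital C*-algebra $A$ has the tracial Rokhlin property if for every finite set $F \subset A$, every $\varepsilon > 0$, and every positive element $x \in A$ with $\|x\| = 1$, there are mutually orthogonal projections $e_g \in A$ for $g \in G$ such that: $\|\alpha_g(e_h) - e_{gh}\| < \varepsilon$ for all $g, h \in G$; $\|e_g a - a e_g\| < \varepsilon$ for all $g \in G$ and all $a \in F$; with $e = \sum_{g \in G} e_g$, the projection $1 - e$ is Murray-von Neumann equivalent to a projection in the hereditary subalgebra of $A$ generated by $x$; and $\|e x e\| > 1 - \varepsilon$. *)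

theory Defs
  imports "HOL-Analysis.Analysis" "HOL-Algebra.Group"
begin

section \<open>Unital C*-algebras\<close>

text \<open>The library has real normed algebras only. The class below adds the complex scalar
  multiplication (extending the real one) and the involution. The superclasses give a unital
  algebra with submultiplicative complete norm and \<open>norm 1 = 1\<close>; in particular the zero algebra
  is excluded.\<close>

class unital_cstar_algebra = real_normed_algebra_1 + banach +
  fixes scaleC :: "complex \<Rightarrow> 'a \<Rightarrow> 'a"  (infixr \<open>*\<^sub>C\<close> 75)
    and star :: "'a \<Rightarrow> 'a"
  assumes scaleC_add_right: "c *\<^sub>C (x + y) = c *\<^sub>C x + c *\<^sub>C y"
    and scaleC_add_left: "(c + d) *\<^sub>C x = c *\<^sub>C x + d *\<^sub>C x"
    and scaleC_scaleC: "c *\<^sub>C (d *\<^sub>C x) = (c * d) *\<^sub>C x"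
    and scaleC_complex_of_real: "complex_of_real r *\<^sub>C x = r *\<^sub>R x"
    and scaleC_mult_left: "(c *\<^sub>C x) * y = c *\<^sub>C (x * y)"
    and scaleC_mult_right: "x * (c *\<^sub>C y) = c *\<^sub>C (x * y)"
    and norm_scaleC: "norm (c *\<^sub>C x) = cmod c * norm x"
    and star_star: "star (star x) = x"
    and star_add: "star (x + y) = star x + star y"
    and star_scaleC: "star (c *\<^sub>C x) = cnj c *\<^sub>C star x"
    and star_mult: "star (x * y) = star y * star x"
    and cstar_identity: "norm (star x * x) = (norm x)\<^sup>2"

global_interpretation complex_vector:
  vector_space "scaleC :: complex \<Rightarrow> 'a \<Rightarrow> 'a::unital_cstar_algebra"
proof
  fix c d :: complex and x y :: 'a
  show "c *\<^sub>C (x + y) = c *\<^sub>C x + c *\<^sub>C y" by (rule scaleC_add_right)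
  show "(c + d) *\<^sub>C x = c *\<^sub>C x + d *\<^sub>C x" by (rule scaleC_add_left)
  show "c *\<^sub>C (d *\<^sub>C x) = (c * d) *\<^sub>C x" by (rule scaleC_scaleC)
  show "1 *\<^sub>C x = x" using scaleC_complex_of_real[of 1 x] by simp
qed

definition infinite_dimensional :: "'a::unital_cstar_algebra itself \<Rightarrow> bool" where
  "infinite_dimensional _ \<longleftrightarrow>
     \<not> (\<exists>B :: 'a set. finite B \<and> complex_vector.span B = UNIV)"

definition separable :: "'a::unital_cstar_algebra itself \<Rightarrow> bool" where
  "separable _ \<longleftrightarrow> (\<exists>D :: 'a set. countable D \<and> closure D = UNIV)"

definition closed_ideal :: "'a::unital_cstar_algebra set \<Rightarrow> bool" where
  "closed_ideal I \<longleftrightarrow> complex_vector.subspace I \<and> closed I \<and>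
     (\<forall>a. \<forall>x\<in>I. a * x \<in> I \<and> x * a \<in> I)"

definition simple_cstar :: "'a::unital_cstar_algebra itself \<Rightarrow> bool" where
  "simple_cstar _ \<longleftrightarrow> (\<forall>I :: 'a set. closed_ideal I \<longrightarrow> I = {0} \<or> I = UNIV)"

definition spectrum :: "'a::unital_cstar_algebra \<Rightarrow> complex set" where
  "spectrum a = {z. \<not> (\<exists>b. (a - z *\<^sub>C 1) * b = 1 \<and> b * (a - z *\<^sub>C 1) = 1)}"

definition positive_elem :: "'a::unital_cstar_algebra \<Rightarrow> bool" where
  "positive_elem a \<longleftrightarrow> star a = a \<and> spectrum a \<subseteq> complex_of_real ` {0..}"

definition projection :: "'a::unital_cstar_algebra \<Rightarrow> bool" where
  "projection p \<longleftrightarrow> star p = p \<and> p * p = p"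

definition murray_von_neumann_equiv :: "'a::unital_cstar_algebra \<Rightarrow> 'a \<Rightarrow> bool" where
  "murray_von_neumann_equiv p q \<longleftrightarrow> (\<exists>v. star v * v = p \<and> v * star v = q)"

text \<open>C*-subalgebras are not required to contain the unit of the ambient algebra.\<close>

definition cstar_subalgebra :: "'a::unital_cstar_algebra set \<Rightarrow> bool" where
  "cstar_subalgebra B \<longleftrightarrow> complex_vector.subspace B \<and> closed B \<and>
     (\<forall>x\<in>B. \<forall>y\<in>B. x * y \<in> B) \<and> (\<forall>x\<in>B. star x \<in> B)"

text \<open>The order is \<open>a \<le> b\<close> iff \<open>b - a\<close> is positive.\<close>

definition hereditary_subalgebra :: "'a::unital_cstar_algebra set \<Rightarrow> bool" where
  "hereditary_subalgebra B \<longleftrightarrow> cstar_subalgebra B \<and>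
     (\<forall>a b. positive_elem a \<and> positive_elem b \<and> positive_elem (b - a) \<and> b \<in> B \<longrightarrow> a \<in> B)"

definition hereditary_generated :: "'a::unital_cstar_algebra \<Rightarrow> 'a set" where
  "hereditary_generated x = hereditary_subalgebra hull {x}"


section \<open>Actions of groups\<close>

definition star_automorphism :: "('a::unital_cstar_algebra \<Rightarrow> 'a) \<Rightarrow> bool" where
  "star_automorphism f \<longleftrightarrow> bij f \<and>
     (\<forall>x y. f (x + y) = f x + f y) \<and>
     (\<forall>c x. f (c *\<^sub>C x) = c *\<^sub>C f x) \<and>
     (\<forall>x y. f (x * y) = f x * f y) \<and>
     (\<forall>x. f (star x) = star (f x))"

definition cstar_Aut :: "('a::unital_cstar_algebra \<Rightarrow> 'a) monoid" where
  "cstar_Aut = \<lparr>carrier = {f. star_automorphism f}, mult = (\<circ>), one = id\<rparr>"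

lemma group_cstar_Aut: "group (cstar_Aut :: ('a::unital_cstar_algebra \<Rightarrow> 'a) monoid)"
proof (rule groupI)
  fix f :: "'a \<Rightarrow> 'a"
  assume "f \<in> carrier cstar_Aut"
  then have f: "star_automorphism f" by (simp add: cstar_Aut_def)
  then have b: "bij f" by (simp add: star_automorphism_def)
  have fi: "f (inv_into UNIV f x) = x" for x
    using b by (simp add: bij_is_surj surj_f_inv_f)
  have eqI: "x = y" if "f x = f y" for x y
    using b that by (meson bij_def injD)
  have "star_automorphism (inv_into UNIV f)"
    unfolding star_automorphism_def
  proof (intro conjI allI)
    show "bij (inv_into UNIV f)" using b by (rule bij_imp_bij_inv)
  qed (rule eqI, use f in \<open>simp add: star_automorphism_def fi\<close>)+
  moreover have "inv_into UNIV f \<circ> f = id" using b by (simp add: bij_is_inj)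
  ultimately show "\<exists>g\<in>carrier cstar_Aut. g \<otimes>\<^bsub>cstar_Aut\<^esub> f = \<one>\<^bsub>cstar_Aut\<^esub>"
    by (auto simp: cstar_Aut_def)
qed (auto simp: cstar_Aut_def star_automorphism_def bij_comp)

definition finite_group_action ::
    "('g, 'm) monoid_scheme \<Rightarrow> ('g \<Rightarrow> 'a \<Rightarrow> 'a::unital_cstar_algebra) \<Rightarrow> bool" where
  "finite_group_action G \<alpha> \<longleftrightarrow> group G \<and> finite (carrier G) \<and> \<alpha> \<in> hom G cstar_Aut"

definition orthogonal_projections :: "'g set \<Rightarrow> ('g \<Rightarrow> 'a::unital_cstar_algebra) \<Rightarrow> bool" where
  "orthogonal_projections S e \<longleftrightarrow>
     (\<forall>g\<in>S. projection (e g)) \<and> (\<forall>g\<in>S. \<forall>h\<in>S. g \<noteq> h \<longrightarrow> e g * e h = 0)"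

definition tracial_rokhlin_property ::
    "('g, 'm) monoid_scheme \<Rightarrow> ('g \<Rightarrow> 'a \<Rightarrow> 'a::unital_cstar_algebra) \<Rightarrow> bool" where
  "tracial_rokhlin_property G \<alpha> \<longleftrightarrow>
     (\<forall>(F :: 'a set) (\<epsilon> :: real) (x :: 'a).
        finite F \<longrightarrow> \<epsilon> > 0 \<longrightarrow> positive_elem x \<longrightarrow> norm x = 1 \<longrightarrow>
        (\<exists>e :: 'g \<Rightarrow> 'a. orthogonal_projections (carrier G) e \<and>
           (\<forall>g\<in>carrier G. \<forall>h\<in>carrier G. norm (\<alpha> g (e h) - e (g \<otimes>\<^bsub>G\<^esub> h)) < \<epsilon>) \<and>
           (\<forall>g\<in>carrier G. \<forall>a\<in>F. norm (e g * a - a * e g) < \<epsilon>) \<and>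
           (let s = \<Sum>g\<in>carrier G. e g in
              (\<exists>q\<in>hereditary_generated x. projection q \<and> murray_von_neumann_equiv (1 - s) q) \<and>
              norm (s * x * s) > 1 - \<epsilon>)))"

end

theory Submission
  imports Defs
begin

text \<open>For the nontrivial direction, let \<open>e\<close> be almost equivariant. The projections
  \<open>q h = \<alpha> h (e \<one>)\<close> are exactly equivariant and close to \<open>e h\<close>, but only almost orthogonal.
  Functional calculus of the invariant element \<open>1 - (\<Sum>h. q h)\<close> gives an invariant projection \<open>r\<close>
  that makes \<open>S = r + (\<Sum>h. q h)\<close> close to \<open>1\<close>, and the elements
  \<open>p h = S\<^bsup>-1/2\<^esup> * q h * S\<^bsup>-1/2\<^esup>\<close> are mutually orthogonal projections, still equivariant
  because \<open>S\<close> is invariant. Norm estimates transfer the commutator and corner conditions from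
  \<open>e\<close> to \<open>p\<close>, and close projections are Murray-von Neumann equivalent. The only functional
  calculus needed is the binomial series of \<open>S\<^bsup>-1/2\<^esup>\<close>, which commutes with automorphisms since these
  are contractive.\<close>

section \<open>Inverse square roots near the unit\<close>

text \<open>The Taylor coefficients of (1 - t)^(-1/2), that is binomial(2k, k) / 4^k. The sign
  factor makes the expansion one in \<open>1 - s\<close> with nonnegative coefficients.\<close>

definition rsqrt_coeff :: "nat \<Rightarrow> real" where
  "rsqrt_coeff k = (- 1) ^ k * ((- 1 / 2) gchoose k)"

definition rsqrt :: "'a::{real_normed_algebra_1,banach} \<Rightarrow> 'a" where
  "rsqrt s = (\<Sum>k. rsqrt_coeff k *\<^sub>R (1 - s) ^ k)"

lemma rsqrt_coeff_0 [simp]: "rsqrt_coeff 0 = 1"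
  by (simp add: rsqrt_coeff_def)

lemma rsqrt_coeff_Suc: "rsqrt_coeff (Suc k) = rsqrt_coeff k * ((real k + 1 / 2) / (real k + 1))"
proof -
  have *: "rsqrt_coeff n = pochhammer (1 / 2) n / fact n" for n
    by (simp add: rsqrt_coeff_def gbinomial_pochhammer flip: power_mult_distrib mult.assoc)
  show ?thesis
    unfolding * by (simp add: pochhammer_Suc field_simps)
qed

lemma rsqrt_coeff_bounds: "0 \<le> rsqrt_coeff k \<and> rsqrt_coeff k \<le> 1"
proof (induction k)
  case (Suc k)
  have "0 \<le> (real k + 1 / 2) / (real k + 1)" "(real k + 1 / 2) / (real k + 1) \<le> 1"
    by simp_all
  with Suc show ?case
    by (simp only: rsqrt_coeff_Suc mult_nonneg_nonneg mult_le_one simp_thms)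
qed simp

text \<open>Chu-Vandermonde with both exponents -1/2, followed by (-1 choose k) = (-1)^k: the square
  of the series of (1 - t)^(-1/2) is the geometric series.\<close>

lemma rsqrt_coeff_convolution: "(\<Sum>i\<le>k. rsqrt_coeff i * rsqrt_coeff (k - i)) = 1"
proof -
  have "(\<Sum>i\<le>k. rsqrt_coeff i * rsqrt_coeff (k - i))
      = (\<Sum>i\<le>k. (- 1) ^ k * (((- 1 / 2) gchoose i) * ((- 1 / 2) gchoose (k - i))))"
  proof (rule sum.cong)
    fix i assume "i \<in> {..k}"
    then have "(- 1 :: real) ^ k = (- 1) ^ i * (- 1) ^ (k - i)"
      by (simp flip: power_add)
    then show "rsqrt_coeff i * rsqrt_coeff (k - i)
        = (- 1) ^ k * (((- 1 / 2) gchoose i) * ((- 1 / 2) gchoose (k - i)))"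
      by (simp add: rsqrt_coeff_def)
  qed simp
  also have "\<dots> = (- 1) ^ k * ((- 1 / 2 + - 1 / 2 :: real) gchoose k)"
    unfolding sum_distrib_left[symmetric]
    by (subst gbinomial_Vandermonde[unfolded atLeast0AtMost]) simp
  also have "\<dots> = 1"
    by (simp add: gbinomial_pochhammer flip: pochhammer_fact power_mult_distrib)
  finally show ?thesis .
qed

context
  fixes s :: "'a::{real_normed_algebra_1,banach}"
  assumes near: "norm (1 - s) < 1"
begin

lemma rsqrt_term_bound: "norm (rsqrt_coeff k *\<^sub>R (1 - s) ^ k) \<le> norm (1 - s) ^ k"
  using mult_mono[of "rsqrt_coeff k" 1 "norm ((1 - s) ^ k)" "norm (1 - s) ^ k"]
    rsqrt_coeff_bounds[of k] norm_power_ineq[of "1 - s" k] by simp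

lemma rsqrt_abs_summable: "summable (\<lambda>k. norm (rsqrt_coeff k *\<^sub>R (1 - s) ^ k))"
  by (rule summable_comparison_test'[of "\<lambda>k. norm (1 - s) ^ k" 0])
    (use near rsqrt_term_bound in \<open>simp_all add: summable_geometric\<close>)

lemma rsqrt_sums: "(\<lambda>k. rsqrt_coeff k *\<^sub>R (1 - s) ^ k) sums rsqrt s"
  unfolding rsqrt_def using rsqrt_abs_summable by (rule summable_sums[OF summable_norm_cancel])

lemma rsqrt_commute:
  assumes "s * b = b * s"
  shows "rsqrt s * b = b * rsqrt s"
proof -
  have "(1 - s) ^ k * b = b * (1 - s) ^ k" for k
  proof (rule power_commuting_commutes)
    show "(1 - s) * b = b * (1 - s)"
      using assms by (simp add: algebra_simps)
  qed
  then have "(\<lambda>k. rsqrt_coeff k *\<^sub>R (1 - s) ^ k * b) = (\<lambda>k. b * (rsqrt_coeff k *\<^sub>R (1 - s) ^ k))"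
    by simp
  then show ?thesis
    using sums_mult2[OF rsqrt_sums, of b] sums_mult[OF rsqrt_sums, of b] sums_unique2 by metis
qed

text \<open>The Cauchy product turns \<open>rsqrt s * rsqrt s\<close> into the Neumann series in
  \<open>1 - s\<close>, which telescopes after multiplication by \<open>s\<close>.\<close>

lemma rsqrt_mult_self: "rsqrt s * rsqrt s * s = 1"
proof -
  let ?c = "\<lambda>k. rsqrt_coeff k *\<^sub>R (1 - s) ^ k"
  have "(\<Sum>i\<le>k. ?c i * ?c (k - i)) = (1 - s) ^ k" for k
  proof -
    have "(\<Sum>i\<le>k. ?c i * ?c (k - i))
        = (\<Sum>i\<le>k. (rsqrt_coeff i * rsqrt_coeff (k - i)) *\<^sub>R (1 - s) ^ k)"
      by (rule sum.cong) (simp_all flip: power_add)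
    then show ?thesis
      by (simp only: rsqrt_coeff_convolution scaleR_one flip: scaleR_left.sum)
  qed
  then have "(\<lambda>k. (1 - s) ^ k) sums (rsqrt s * rsqrt s)"
    using Cauchy_product_sums[OF rsqrt_abs_summable rsqrt_abs_summable]
    by (simp add: rsqrt_def)
  from sums_mult2[OF this, of s]
  have *: "(\<lambda>k. (1 - s) ^ k * s) sums (rsqrt s * rsqrt s * s)" .
  have "(\<lambda>k. (1 - s) ^ k) \<longlonglongrightarrow> 0"
    using near by (rule LIMSEQ_power_zero)
  then have "(\<lambda>k. (1 - s) ^ k - (1 - s) ^ Suc k) sums ((1 - s) ^ 0 - 0)"
    by (rule telescope_sums')
  moreover have "(1 - s) ^ k - (1 - s) ^ Suc k = (1 - s) ^ k * s" for k
    by (simp add: power_Suc2 algebra_simps del: power_Suc)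
  ultimately show ?thesis
    using * sums_unique2 by fastforce
qed

lemma rsqrt_conj_self: "rsqrt s * s * rsqrt s = 1"
  using rsqrt_mult_self by (simp only: mult.assoc flip: rsqrt_commute[OF refl])

lemma rsqrt_mult_self_right: "s * (rsqrt s * rsqrt s) = 1"
  using rsqrt_conj_self by (simp add: rsqrt_commute[OF refl] flip: mult.assoc)

text \<open>The coefficients are at most 1, so without its leading term 1 the series is dominated by
  a geometric series that starts at exponent 1.\<close>

lemma norm_rsqrt_minus_1: "norm (rsqrt s - 1) \<le> norm (1 - s) / (1 - norm (1 - s))"
proof -
  let ?z = "norm (1 - s)"
  have "(\<lambda>k. rsqrt_coeff (Suc k) *\<^sub>R (1 - s) ^ Suc k) sums (rsqrt s - 1)"
    using rsqrt_sums by (subst sums_Suc_iff) simp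
  moreover have "(\<lambda>k. ?z ^ k * ?z) sums (1 / (1 - ?z) * ?z)"
    using near by (intro sums_mult2 geometric_sums) simp
  ultimately show ?thesis
    using norm_suminf_le[of "\<lambda>k. rsqrt_coeff (Suc k) *\<^sub>R (1 - s) ^ Suc k" "\<lambda>k. ?z ^ k * ?z"]
      rsqrt_term_bound[of "Suc _"]
    by (simp add: sums_iff mult.commute)
qed

end

section \<open>Unital C*-algebras\<close>

lemma scaleC_i_i: "\<i> *\<^sub>C \<i> *\<^sub>C (x::'a::unital_cstar_algebra) = - x"
  using scaleC_complex_of_real[of "-1" x] by (simp add: scaleC_scaleC)

lemma star_scaleR: "star (r *\<^sub>R x) = r *\<^sub>R star (x::'a::unital_cstar_algebra)"
  by (metis complex_cnj_complex_of_real scaleC_complex_of_real star_scaleC)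

lemma star_1 [simp]: "star (1::'a::unital_cstar_algebra) = 1"
  by (metis mult.right_neutral mult.left_neutral star_mult star_star)

lemma additive_star: "Modules.additive (star :: 'a::unital_cstar_algebra \<Rightarrow> 'a)"
  by unfold_locales (rule star_add)

lemmas star_diff = Modules.additive.diff[OF additive_star]
  and star_sum = Modules.additive.sum[OF additive_star]

text \<open>The C*-identity and submultiplicativity give one inequality; its instance at
  \<open>star x\<close> is the other.\<close>

lemma norm_star [simp]: "norm (star x) = norm (x::'a::unital_cstar_algebra)"
proof -
  have "norm y \<le> norm (star y)" for y :: 'a
  proof (cases "y = 0")
    case False
    have "(norm y)\<^sup>2 \<le> norm (star y) * norm y"
      using norm_mult_ineq[of "star y" y] by (simp add: cstar_identity)
    with False show ?thesis
      by (simp add: power2_eq_square)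
  qed simp
  from this[of x] this[of "star x"] show ?thesis
    by (simp add: star_star)
qed

lemma bounded_linear_star: "bounded_linear (star :: 'a::unital_cstar_algebra \<Rightarrow> 'a)"
  by (rule bounded_linear_intro[of _ 1]) (simp_all add: star_add star_scaleR)

lemma star_power: "star (x ^ k) = star (x::'a::unital_cstar_algebra) ^ k"
  by (induction k) (simp_all add: star_mult power_commutes)

lemma star_rsqrt:
  fixes s :: "'a::unital_cstar_algebra"
  assumes "norm (1 - s) < 1" "star s = s"
  shows "star (rsqrt s) = rsqrt s"
  using bounded_linear.sums[OF bounded_linear_star rsqrt_sums[OF assms(1)]] rsqrt_sums[OF assms(1)]
  by (simp add: star_scaleR star_power star_diff assms(2) sums_unique2)

lemma norm_selfadjoint_square: "star x = x \<Longrightarrow> norm (x * x) = (norm (x::'a::unital_cstar_algebra))\<^sup>2"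
  using cstar_identity[of x] by simp

lemma norm_projection_le:
  assumes "projection (p::'a::unital_cstar_algebra)"
  shows "norm p \<le> 1"
proof -
  have "norm p = (norm p)\<^sup>2"
    using assms norm_selfadjoint_square[of p] by (simp add: projection_def)
  then show ?thesis
    by (metis mult_cancel_right2 norm_ge_zero order_refl power2_eq_square zero_le_one)
qed

lemma norm_mult_diff_le:
  fixes a b c d :: "'a::real_normed_algebra"
  assumes "norm a \<le> K" "norm d \<le> L"
  shows "norm (a * b - c * d) \<le> K * norm (b - d) + L * norm (a - c)"
proof -
  have "a * b - c * d = a * (b - d) + (a - c) * d"
    by (simp add: algebra_simps)
  then have "norm (a * b - c * d) \<le> norm a * norm (b - d) + norm (a - c) * norm d"
    using norm_triangle_ineq[of "a * (b - d)" "(a - c) * d"] norm_mult_ineq[of a "b - d"]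
      norm_mult_ineq[of "a - c" d] by simp
  also have "\<dots> \<le> K * norm (b - d) + norm (a - c) * L"
    using assms by (intro add_mono mult_right_mono mult_left_mono) auto
  finally show ?thesis
    by (simp add: mult.commute)
qed

section \<open>Automorphisms are contractive\<close>

context
  fixes \<phi> :: "'a::unital_cstar_algebra \<Rightarrow> 'a"
  assumes aut: "star_automorphism \<phi>"
begin

lemma star_automorphism_simps:
  "\<phi> (x + y) = \<phi> x + \<phi> y" "\<phi> (c *\<^sub>C x) = c *\<^sub>C \<phi> x" "\<phi> (x * y) = \<phi> x * \<phi> y"
  "\<phi> (star x) = star (\<phi> x)" "\<phi> (r *\<^sub>R x) = r *\<^sub>R \<phi> x"
  using aut by (simp_all add: star_automorphism_def flip: scaleC_complex_of_real)

lemma additive_star_automorphism: "Modules.additive \<phi>"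
  by unfold_locales (rule star_automorphism_simps)

lemma star_automorphism_1: "\<phi> 1 = 1"
proof -
  from aut obtain y where "\<phi> y = 1"
    unfolding star_automorphism_def by (metis bij_pointE)
  then show ?thesis
    using star_automorphism_simps(3)[of 1 y] by simp
qed

text \<open>If \<open>1 - a\<^sup>2 = d\<^sup>2\<close> with \<open>d\<close> self-adjoint and commuting with \<open>a\<close>, then
  \<open>\<phi> a + i \<phi> d\<close> is an isometry with real part \<open>\<phi> a\<close>.\<close>

lemma norm_star_automorphism_selfadjoint:
  assumes "star a = a" "norm a < 1"
  shows "norm (\<phi> a) \<le> 1"
proof -
  define s where "s = 1 - a * a"
  \<comment> \<open>This is the square root of \<open>s\<close>, obtained as s^(-1/2) s, so that no
    second power series is needed.\<close>
  define d where "d = rsqrt s * s"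
  have near: "norm (1 - s) < 1"
    using assms by (simp add: s_def norm_selfadjoint_square power_less_one_iff)
  have [simp]: "star s = s"
    using assms by (simp add: s_def star_diff star_mult)
  have rs: "rsqrt s * s = s * rsqrt s"
    by (rule rsqrt_commute[OF near refl])
  have sa: "s * a = a * s"
    by (simp add: s_def algebra_simps)
  then have ra: "rsqrt s * a = a * rsqrt s"
    by (rule rsqrt_commute[OF near])
  have sd: "star d = d"
    by (simp add: d_def star_mult star_rsqrt[OF near] rs)
  have da: "d * a = a * d"
    unfolding d_def by (metis mult.assoc ra sa)
  have "d * d = rsqrt s * rsqrt s * s * s"
    unfolding d_def by (metis mult.assoc rs)
  then have "d * d = s"
    by (simp add: rsqrt_mult_self[OF near])
  then have "a * a + d * d = 1"
    by (simp add: s_def)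
  then have sq: "\<phi> a * \<phi> a + \<phi> d * \<phi> d = 1"
    by (metis star_automorphism_simps(1,3) star_automorphism_1)
  have comm: "\<phi> d * \<phi> a = \<phi> a * \<phi> d"
    by (metis da star_automorphism_simps(3))
  define w where "w = \<phi> a + \<i> *\<^sub>C \<phi> d"
  have st: "star (\<phi> a) = \<phi> a" "star (\<phi> d) = \<phi> d"
    by (metis assms(1) star_automorphism_simps(4), metis sd star_automorphism_simps(4))
  then have sw: "star w = \<phi> a - \<i> *\<^sub>C \<phi> d"
    by (simp add: w_def star_add star_scaleC)
  have "star w * w = 1"
    unfolding sw unfolding w_def using sq comm
    by (simp add: algebra_simps scaleC_mult_left scaleC_mult_right scaleC_i_i)
  \<comment> \<open>By the C*-identity. Since \<open>star w\<close> has the same norm, the real part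
    of \<open>w\<close> has norm at most 1.\<close>
  then have "norm w = 1"
    using cstar_identity[of w] by (simp add: power2_eq_1_iff) (smt (verit) norm_ge_zero)
  then have "norm (w + star w) \<le> 2"
    using norm_triangle_ineq[of w "star w"] by simp
  moreover have "w + star w = 2 *\<^sub>R \<phi> a"
    unfolding sw unfolding w_def by (simp add: scaleR_2)
  ultimately show ?thesis
    by simp
qed

text \<open>The C*-identity reduces the claim to the self-adjoint element \<open>star x * x\<close>.
  Scaling by a number slightly larger than the square of \<open>norm x\<close> provides the strict
  bound that the self-adjoint case requires.\<close>

lemma norm_star_automorphism_le: "norm (\<phi> x) \<le> norm x"
proof (rule field_le_epsilon)
  fix e :: real
  assume e: "e > 0"
  define t where "t = norm x + e"
  have t: "t > 0" "norm x < t"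
    using e by (simp_all add: t_def add_nonneg_pos)
  define a where "a = (1 / t\<^sup>2) *\<^sub>R (star x * x)"
  have "star a = a"
    by (simp add: a_def star_scaleR star_mult star_star)
  moreover have "norm a < 1"
    using t by (simp add: a_def cstar_identity power_strict_mono)
  ultimately have "norm (\<phi> a) \<le> 1"
    by (rule norm_star_automorphism_selfadjoint)
  moreover have "\<phi> a = (1 / t\<^sup>2) *\<^sub>R (star (\<phi> x) * \<phi> x)"
    by (simp add: a_def star_automorphism_simps)
  ultimately have "(norm (\<phi> x))\<^sup>2 \<le> t\<^sup>2"
    using t by (simp add: cstar_identity)
  then show "norm (\<phi> x) \<le> norm x + e"
    using t by (simp add: power2_le_iff_abs_le t_def)
qed

lemma bounded_linear_star_automorphism: "bounded_linear \<phi>"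
  by (rule bounded_linear_intro[of _ 1])
    (simp_all add: star_automorphism_simps norm_star_automorphism_le)

lemma star_automorphism_power: "\<phi> (x ^ k) = \<phi> x ^ k"
  by (induction k) (simp_all add: star_automorphism_simps star_automorphism_1)

text \<open>Continuity lets \<phi> pass through the series, each of whose terms it fixes.\<close>

lemma star_automorphism_rsqrt:
  assumes "norm (1 - s) < 1" "\<phi> s = s"
  shows "\<phi> (rsqrt s) = rsqrt s"
  using bounded_linear.sums[OF bounded_linear_star_automorphism rsqrt_sums[OF assms(1)]]
    rsqrt_sums[OF assms(1)]
  by (simp add: star_automorphism_simps star_automorphism_power star_automorphism_1
      Modules.additive.diff[OF additive_star_automorphism] assms(2) sums_unique2)

end

section \<open>Perturbation of projections\<close>

text \<open>The element z = q p + (1 - q)(1 - p) satisfies z p = q z, and \<open>star z * z\<close>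
  and \<open>z * star z\<close> both equal s = 1 - (p - q)^2, which is invertible. Hence z s^(-1/2)
  is a unitary conjugating \<open>p\<close> to \<open>q\<close>, and its product with
  \<open>p\<close> is the required partial isometry.\<close>

lemma close_projections_equiv:
  fixes p q :: "'a::unital_cstar_algebra"
  assumes "projection p" "projection q" "norm (p - q) < 1"
  shows "murray_von_neumann_equiv p q"
proof -
  have p: "star p = p" "p * p = p" and q: "star q = q" "q * q = q"
    using assms by (auto simp: projection_def)
  have pa: "p * (p * x) = p * x" and qa: "q * (q * x) = q * x" for x
    by (metis mult.assoc p(2), metis mult.assoc q(2))
  define s where "s = 1 - (p - q) * (p - q)"
  define z where "z = q * p + (1 - q) * (1 - p)"
  have near: "norm (1 - s) < 1"
    using assms by (simp add: s_def norm_selfadjoint_square star_diff p q power_less_one_iff)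
  have ss: "star s = s"
    by (simp add: s_def star_diff star_mult p q)
  have z1: "star z * z = s" and z2: "z * star z = s" and zp: "z * p = q * p" and qz: "q * z = q * p"
    by (simp_all add: z_def s_def star_add star_diff star_mult p q pa qa algebra_simps)
  have sp: "s * p = p * s"
    by (simp add: s_def p q pa qa algebra_simps)
  \<comment> \<open>Both sides are z z* z.\<close>
  have sz: "s * z = z * s"
    by (metis mult.assoc z1 z2)
  define r where "r = rsqrt s"
  have sr: "star r = r"
    unfolding r_def by (rule star_rsqrt[OF near ss])
  have rp: "r * p = p * r"
    unfolding r_def by (rule rsqrt_commute[OF near sp])
  have rz: "r * z = z * r"
    unfolding r_def by (rule rsqrt_commute[OF near sz])
  have rrs: "r * r * s = 1"
    unfolding r_def by (rule rsqrt_mult_self[OF near])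
  have rs: "r * s = s * r"
    unfolding r_def by (rule rsqrt_commute[OF near refl])
  have "star (z * r * p) * (z * r * p) = p * r * (star z * z) * r * p"
    by (simp add: star_mult p sr mult.assoc)
  also have "\<dots> = p * (r * r * s) * p"
    by (metis z1 mult.assoc rs)
  finally have 1: "star (z * r * p) * (z * r * p) = p"
    by (simp add: rrs p)
  have "z * r * p * star (z * r * p) = z * r * p * r * star z"
    by (simp add: star_mult p sr mult.assoc pa)
  also have "\<dots> = z * p * r * r * star z"
    by (metis mult.assoc rp)
  also have "\<dots> = q * (z * r * r * star z)"
    by (simp add: zp flip: qz mult.assoc)
  also have "\<dots> = q * (r * r * (z * star z))"
    by (metis mult.assoc rz)
  finally have 2: "z * r * p * star (z * r * p) = q"
    by (simp add: z2 rrs)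
  from 1 2 show ?thesis
    unfolding murray_von_neumann_equiv_def by blast
qed

lemma murray_von_neumann_equiv_trans:
  fixes p q r :: "'a::unital_cstar_algebra"
  assumes "projection p" "projection r"
    and "murray_von_neumann_equiv p q" "murray_von_neumann_equiv q r"
  shows "murray_von_neumann_equiv p r"
proof -
  from assms obtain v w where v: "star v * v = p" "v * star v = q"
    and w: "star w * w = q" "w * star w = r"
    unfolding murray_von_neumann_equiv_def by blast
  have "star (w * v) * (w * v) = star v * (star w * w) * v"
    by (simp add: star_mult mult.assoc)
  also have "\<dots> = (star v * v) * (star v * v)"
    by (simp add: w flip: v) (simp add: mult.assoc)
  finally have 1: "star (w * v) * (w * v) = p"
    using assms by (simp add: v projection_def)
  have "(w * v) * star (w * v) = w * (v * star v) * star w"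
    by (simp add: star_mult mult.assoc)
  also have "\<dots> = (w * star w) * (w * star w)"
    by (simp add: v flip: w) (simp add: mult.assoc)
  finally have 2: "(w * v) * star (w * v) = r"
    using assms by (simp add: w projection_def)
  from 1 2 show ?thesis
    unfolding murray_von_neumann_equiv_def by blast
qed

text \<open>The self-adjoint unitary \<open>y (y\<^sup>2)\<^bsup>-1/2\<^esup>\<close> with \<open>y = 2 w - 1\<close> is the sign of \<open>y\<close>.\<close>

lemma projection_near_selfadjoint:
  fixes w e :: "'a::unital_cstar_algebra"
  assumes "star w = w" "projection e" "norm (w - e) \<le> \<eta>" "\<eta> \<le> 1 / 20"
  obtains q where "projection q" "norm (q - e) \<le> 20 * \<eta>"
    "\<And>\<phi>. star_automorphism \<phi> \<Longrightarrow> \<phi> w = w \<Longrightarrow> \<phi> q = q"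
proof -
  have e: "star e = e" "e * e = e"
    using assms by (auto simp: projection_def)
  have \<eta>: "0 \<le> \<eta>"
    using assms(3) norm_ge_zero order_trans by blast
  \<comment> \<open>Under p -> 2 p - 1 projections correspond to self-adjoint unitaries, so it
    suffices to correct \<open>y\<close> to a self-adjoint unitary near \<open>c\<close>.\<close>
  define y where "y = 2 *\<^sub>R w - 1"
  define c where "c = 2 *\<^sub>R e - 1"
  have sy: "star y = y" and sc: "star c = c" and cc: "c * c = 1"
    using assms(1) e by (simp_all add: y_def c_def star_diff star_scaleR star_add algebra_simps scaleR_2)
  have nc: "norm c \<le> 1"
    using norm_selfadjoint_square[OF sc] cc abs_square_le_1[of "norm c"] by simp
  have yc: "norm (y - c) \<le> 2 * \<eta>"
  proof -
    have "y - c = 2 *\<^sub>R (w - e)"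
      by (simp add: y_def c_def algebra_simps)
    then show ?thesis
      using assms(3) by simp
  qed
  have ny: "norm y \<le> 11 / 10"
    using norm_triangle_ineq[of "y - c" c] yc nc assms(4) by simp
  \<comment> \<open>As \<open>c * c = 1\<close>, this puts \<open>y * y\<close> within (11/10 + 1) *
    2 * \<eta> = 21/5 * \<eta> of 1, hence within 21/100.\<close>
  have "norm (y * y - c * c) \<le> 11 / 10 * norm (y - c) + 1 * norm (y - c)"
    using ny nc by (rule norm_mult_diff_le)
  then have n1: "norm (1 - y * y) \<le> 21 / 5 * \<eta>"
    using yc by (simp add: cc norm_minus_commute)
  then have near: "norm (1 - y * y) < 1"
    using assms(4) by simp
  define r where "r = rsqrt (y * y)"
  have rrs: "r * r * (y * y) = 1"
    unfolding r_def by (rule rsqrt_mult_self[OF near])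
  have ry: "r * y = y * r"
    unfolding r_def by (rule rsqrt_commute[OF near]) (simp add: mult.assoc)
  have sr: "star r = r"
    unfolding r_def by (rule star_rsqrt[OF near]) (simp add: star_mult sy)
  define q where "q = (1 / 2) *\<^sub>R (1 + y * r)"
  show thesis
  proof
    have sym: "y * r * (y * r) = 1"
      using rrs by (metis mult.assoc ry)
    have "q * q = (1 / 4) *\<^sub>R (1 + y * r + (y * r + y * r * (y * r)))"
      unfolding q_def by (simp add: distrib_left distrib_right flip: scaleR_add_right)
    also have "\<dots> = q"
      unfolding sym q_def by (simp add: algebra_simps flip: scaleR_2)
    finally show "projection q"
      unfolding projection_def by (simp add: q_def star_scaleR star_add star_mult sr sy ry)
    have "norm (r - 1) \<le> norm (1 - y * y) / (1 - norm (1 - y * y))"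
      unfolding r_def by (rule norm_rsqrt_minus_1[OF near])
    also have "\<dots> \<le> (21 / 5 * \<eta>) / (1 / 2)"
      using n1 assms(4) \<eta> by (intro frac_le) auto
    finally have nr: "norm (r - 1) \<le> 42 / 5 * \<eta>"
      by simp
    have "norm (y * r - c * 1) \<le> 11 / 10 * norm (r - 1) + 1 * norm (y - c)"
      using ny by (rule norm_mult_diff_le) simp
    then have "norm (y * r - c) \<le> 40 * \<eta>"
      using nr yc \<eta> by simp
    moreover have "q - e = (1 / 2) *\<^sub>R (y * r - c)"
      by (simp add: q_def c_def algebra_simps)
    ultimately show "norm (q - e) \<le> 20 * \<eta>"
      by simp
    fix \<phi> :: "'a \<Rightarrow> 'a"
    assume \<phi>: "star_automorphism \<phi>" "\<phi> w = w"
    note [simp] = star_automorphism_simps[OF \<phi>(1)] star_automorphism_1[OF \<phi>(1)]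
    have "\<phi> y = y"
      by (simp add: y_def Modules.additive.diff[OF additive_star_automorphism[OF \<phi>(1)]] \<phi>(2))
    moreover from this have "\<phi> r = r"
      unfolding r_def by (intro star_automorphism_rsqrt[OF \<phi>(1) near]) simp
    ultimately show "\<phi> q = q"
      by (simp add: q_def)
  qed
qed

text \<open>Symmetric (Loewdin) orthogonalization: it depends canonically on the given projections and
  hence preserves equivariance, unlike Gram-Schmidt.\<close>

definition lowdin :: "'i set \<Rightarrow> ('i \<Rightarrow> 'a::unital_cstar_algebra) \<Rightarrow> 'i \<Rightarrow> 'a" where
  "lowdin I q i = rsqrt (sum q I) * q i * rsqrt (sum q I)"

text \<open>At an index where \<open>norm (x i)\<close> attains its maximum m, the equation gives m
  \<le> card I * c * m, which forces m = 0.\<close>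

lemma finite_contraction_zero:
  fixes x :: "'i \<Rightarrow> 'a::real_normed_algebra"
  assumes "finite I" "0 \<le> c" "real (card I) * c < 1"
    and "\<And>i k. i \<in> I \<Longrightarrow> k \<in> I \<Longrightarrow> norm (a i k) \<le> c"
    and "\<And>i. i \<in> I \<Longrightarrow> x i = (\<Sum>k\<in>I. a i k * x k)"
    and "i \<in> I"
  shows "x i = 0"
proof -
  define m where "m = Max ((\<lambda>i. norm (x i)) ` I)"
  have le: "norm (x k) \<le> m" if "k \<in> I" for k
    using that assms(1) by (simp add: m_def)
  have "m \<in> (\<lambda>i. norm (x i)) ` I"
    unfolding m_def using assms(1,6) by (intro Max_in) auto
  then obtain j where j: "j \<in> I" "m = norm (x j)"
    by blast
  have "norm (x j) \<le> (\<Sum>k\<in>I. norm (a j k * x k))"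
    by (subst assms(5)[OF j(1)]) (rule norm_sum)
  also have "\<dots> \<le> (\<Sum>k\<in>I. c * m)"
  proof (rule sum_mono)
    fix k assume "k \<in> I"
    then show "norm (a j k * x k) \<le> c * m"
      using norm_mult_ineq[of "a j k" "x k"] mult_mono[OF assms(4)[OF j(1)] le] assms(2)
      by fastforce
  qed
  also have "\<dots> = real (card I) * c * m"
    by simp
  finally have "m * (1 - real (card I) * c) \<le> 0"
    using j(2) by (simp add: algebra_simps)
  then have "m \<le> 0"
    using assms(3) by (simp add: mult_le_0_iff)
  then show ?thesis
    using le[OF assms(6)] norm_le_zero_iff order_trans by blast
qed

section \<open>Orthogonalization of projections close to a partition of unity\<close>

context
  fixes I :: "'i set" and q e :: "'i \<Rightarrow> 'a::unital_cstar_algebra" and \<eta> :: real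
  assumes fin: "finite I" and ne: "I \<noteq> {}"
    and e: "orthogonal_projections I e" "sum e I = 1"
    and q: "\<And>i. i \<in> I \<Longrightarrow> projection (q i)"
    and close: "\<And>i. i \<in> I \<Longrightarrow> norm (q i - e i) \<le> \<eta>"
    and small: "real (card I) * \<eta> \<le> 1 / 4"
begin

lemma norm_one_minus_sum: "norm (1 - sum q I) \<le> real (card I) * \<eta>"
proof -
  have "norm (1 - sum q I) = norm (\<Sum>i\<in>I. q i - e i)"
    by (simp add: sum_subtractf e norm_minus_commute)
  also have "\<dots> \<le> real (card I) * \<eta>"
    by (rule sum_norm_bound) (rule close)
  finally show ?thesis .
qed

lemma sum_near_1: "norm (1 - sum q I) < 1"
  using norm_one_minus_sum small by linarith

lemma eta_nonneg: "0 \<le> \<eta>"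
  using ne close norm_ge_zero order_trans by blast

lemma almost_orthogonal:
  assumes "i \<in> I" "j \<in> I" "i \<noteq> j"
  shows "norm (q i * q j) \<le> 2 * \<eta>"
proof -
  have "norm (q i * q j - e i * e j) \<le> 1 * norm (q j - e j) + 1 * norm (q i - e i)"
    using assms q e(1)
    by (intro norm_mult_diff_le norm_projection_le) (auto simp: orthogonal_projections_def)
  moreover have "e i * e j = 0"
    using assms e(1) by (simp add: orthogonal_projections_def)
  ultimately show ?thesis
    using close[OF assms(1)] close[OF assms(2)] by simp
qed

text \<open>For fixed \<open>j\<close> the differences \<open>x i\<close> of the two sides satisfy
  \<open>(\<Sum>k\<in>I. q i * q k * x k) = 0\<close>, that is
  \<open>x i = - (\<Sum>k\<in>I - {i}. q i * q k * x k)\<close>, a contraction.\<close>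

lemma lowdin_key:
  assumes "i \<in> I" "j \<in> I"
  shows "q i * (rsqrt (sum q I) * rsqrt (sum q I)) * q j = (if i = j then q j else 0)"
proof -
  define S where "S = sum q I"
  define R where "R = rsqrt S * rsqrt S"
  have near: "norm (1 - S) < 1"
    unfolding S_def by (rule sum_near_1)
  have SR: "S * R = 1"
    unfolding R_def by (rule rsqrt_mult_self_right[OF near])
  define x where "x k = q k * R * q j - (if k = j then q j else 0)" for k
  have qq: "q k * q k = q k" if "k \<in> I" for k
    using q[OF that] by (simp add: projection_def)
  \<comment> \<open>Both parts of \<open>x k\<close> begin with \<open>q k\<close>, so this factor
    can be inserted or dropped freely.\<close>
  have qx: "q k * x k = x k" if "k \<in> I" for k
    using qq[OF that]
    by (cases "k = j") (simp_all add: x_def right_diff_distrib flip: mult.assoc)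
  \<comment> \<open>Already the sum of the \<open>x k\<close> is (S R - 1) q j, which vanishes
    because \<open>R\<close> is the inverse of \<open>S\<close>.\<close>
  have zero: "(\<Sum>k\<in>I. q i * q k * x k) = 0" for i
  proof -
    have "(\<Sum>k\<in>I. q i * q k * x k) = q i * (\<Sum>k\<in>I. q k * x k)"
      by (simp add: sum_distrib_left mult.assoc)
    also have "(\<Sum>k\<in>I. q k * x k) = (\<Sum>k\<in>I. x k)"
      using qx by simp
    also have "(\<Sum>k\<in>I. x k) = S * R * q j - q j"
      using assms(2) fin by (simp add: x_def S_def sum_subtractf sum_distrib_right)
    finally show ?thesis
      by (simp add: SR)
  qed
  \<comment> \<open>The diagonal term is \<open>x i\<close> itself and moves to the other side. The
    off-diagonal coefficients are at most 2 \<eta>, and card I * 2 \<eta> \<le> 1/2 makes the system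
    contractive.\<close>
  have "x i = 0"
  proof (rule finite_contraction_zero[where I = I and c = "2 * \<eta>" and x = x
        and a = "\<lambda>i k. if k = i then 0 else - (q i * q k)"])
    show "x i = (\<Sum>k\<in>I. (if k = i then 0 else - (q i * q k)) * x k)" if "i \<in> I" for i
    proof -
      have "(\<Sum>k\<in>I. (if k = i then 0 else - (q i * q k)) * x k)
          = (\<Sum>k\<in>I - {i}. - (q i * q k * x k))"
        by (rule sum.mono_neutral_cong_right) (use fin in auto)
      also have "\<dots> = q i * q i * x i - (\<Sum>k\<in>I. q i * q k * x k)"
        using that fin by (simp add: sum_negf sum_diff1)
      finally show ?thesis
        using that by (simp add: zero qq qx)
    qed
  qed (use fin assms(1) small eta_nonneg almost_orthogonal in auto)
  then show ?thesis
    by (simp add: x_def R_def S_def)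
qed

text \<open>A product of two members contains the middle factor q i S^(-1) q j, where S is the sum
  of the \<open>q k\<close>; \<open>lowdin_key\<close> evaluates it.\<close>

lemma orthogonal_projections_lowdin: "orthogonal_projections I (lowdin I q)"
proof -
  have mult: "lowdin I q i * lowdin I q j = (if i = j then lowdin I q j else 0)"
    if "i \<in> I" "j \<in> I" for i j
  proof -
    let ?r = "rsqrt (sum q I)"
    have "lowdin I q i * lowdin I q j = ?r * (q i * (?r * ?r) * q j) * ?r"
      by (simp add: lowdin_def mult.assoc)
    then show ?thesis
      by (simp add: lowdin_key[OF that] lowdin_def)
  qed
  have "star (sum q I) = sum q I"
    using q by (simp add: star_sum projection_def)
  then have "star (rsqrt (sum q I)) = rsqrt (sum q I)"
    by (rule star_rsqrt[OF sum_near_1])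
  then have "star (lowdin I q i) = lowdin I q i" if "i \<in> I" for i
    using q[OF that] by (simp add: lowdin_def star_mult projection_def mult.assoc)
  with mult show ?thesis
    by (simp add: orthogonal_projections_def projection_def)
qed

lemma sum_lowdin: "sum (lowdin I q) I = 1"
proof -
  let ?r = "rsqrt (sum q I)"
  have "sum (lowdin I q) I = ?r * sum q I * ?r"
    by (simp add: lowdin_def sum_distrib_left sum_distrib_right)
  then show ?thesis
    by (simp add: rsqrt_conj_self[OF sum_near_1])
qed

lemma lowdin_close:
  assumes "i \<in> I"
  shows "norm (lowdin I q i - e i) \<le> 8 * real (card I) * \<eta>"
proof -
  define r where "r = rsqrt (sum q I)"
  define \<delta> where "\<delta> = real (card I) * \<eta>"
  have \<delta>: "0 \<le> \<delta>" "\<delta> \<le> 1 / 4"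
    using eta_nonneg small by (auto simp: \<delta>_def)
  have "norm (r - 1) \<le> norm (1 - sum q I) / (1 - norm (1 - sum q I))"
    unfolding r_def by (rule norm_rsqrt_minus_1[OF sum_near_1])
  also have "\<dots> \<le> \<delta> / (1 / 2)"
    using norm_one_minus_sum \<delta> by (intro frac_le) (auto simp: \<delta>_def)
  finally have r: "norm (r - 1) \<le> 2 * \<delta>"
    by simp
  have nr: "norm r \<le> 3 / 2"
    using norm_triangle_ineq[of "r - 1" 1] r \<delta> by simp
  have nq: "norm (q i) \<le> 1"
    using q[OF assms] by (rule norm_projection_le)
  have "norm (r * q i) \<le> 3 / 2 * 1"
    using norm_mult_ineq[of r "q i"] mult_mono[OF nr nq] by simp
  then have "norm (r * q i * r - q i * 1) \<le> 3 / 2 * norm (r - 1) + 1 * norm (r * q i - q i)"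
    by (intro norm_mult_diff_le) simp_all
  moreover have "norm (r * q i - 1 * q i) \<le> 3 / 2 * norm (q i - q i) + 1 * norm (r - 1)"
    using nr nq by (rule norm_mult_diff_le)
  \<comment> \<open>The right factor costs 3/2 * 2 \<delta> and the left one 2 \<delta>. Adding the
    distance \<eta> \<le> \<delta> from \<open>q i\<close> to \<open>e i\<close> stays below the
    stated 8 \<delta>.\<close>
  ultimately have "norm (r * q i * r - q i) \<le> 5 * \<delta>"
    using r by simp
  moreover have "\<eta> \<le> \<delta>"
    using eta_nonneg fin ne by (simp add: \<delta>_def mult_le_cancel_right1 Suc_le_eq card_gt_0_iff)
  ultimately show ?thesis
    using norm_triangle_ineq[of "r * q i * r - q i" "q i - e i"] close[OF assms] \<delta>(1)
    by (simp add: lowdin_def \<delta>_def flip: r_def)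
qed

text \<open>An automorphism that permutes the \<open>q i\<close> fixes their sum, and with it the
  inverse square root.\<close>

lemma lowdin_equivariant:
  assumes \<phi>: "star_automorphism \<phi>" and \<pi>: "bij_betw \<pi> I I"
    and eq: "\<And>i. i \<in> I \<Longrightarrow> \<phi> (q i) = q (\<pi> i)" and i: "i \<in> I"
  shows "\<phi> (lowdin I q i) = lowdin I q (\<pi> i)"
proof -
  have "\<phi> (sum q I) = (\<Sum>i\<in>I. q (\<pi> i))"
    using eq by (simp add: Modules.additive.sum[OF additive_star_automorphism[OF \<phi>]])
  also have "\<dots> = sum q I"
    using \<pi> by (rule sum.reindex_bij_betw)
  finally have "\<phi> (rsqrt (sum q I)) = rsqrt (sum q I)"
    by (rule star_automorphism_rsqrt[OF \<phi> sum_near_1])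
  then show ?thesis
    using eq[OF i] by (simp add: lowdin_def star_automorphism_simps[OF \<phi>])
qed

end

section \<open>Equivariant families of orthogonal projections\<close>

lemma projection_sum:
  fixes e :: "'g \<Rightarrow> 'a::unital_cstar_algebra"
  assumes "finite S" "orthogonal_projections S e"
  shows "projection (sum e S)"
    and "g \<in> S \<Longrightarrow> e g * sum e S = e g" and "g \<in> S \<Longrightarrow> sum e S * e g = e g"
proof -
  have e: "e g * e h = (if g = h then e g else 0)" if "g \<in> S" "h \<in> S" for g h
    using assms(2) that by (auto simp: orthogonal_projections_def projection_def)
  have *: "e g * sum e S = e g" "sum e S * e g = e g" if "g \<in> S" for g
    using that assms(1) by (simp_all add: sum_distrib_left sum_distrib_right e)
  then show "g \<in> S \<Longrightarrow> e g * sum e S = e g" "g \<in> S \<Longrightarrow> sum e S * e g = e g"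
    by blast+
  have "sum e S * sum e S = sum e S"
    by (subst sum_distrib_right) (simp add: *)
  moreover have "star (sum e S) = sum e S"
    using assms(2) by (simp add: star_sum orthogonal_projections_def projection_def)
  ultimately show "projection (sum e S)"
    by (simp add: projection_def)
qed

lemma projection_one_minus: "projection p \<Longrightarrow> projection (1 - p)"
  by (simp add: projection_def star_diff algebra_simps)

lemma projection_star_automorphism: "star_automorphism \<phi> \<Longrightarrow> projection p \<Longrightarrow> projection (\<phi> p)"
  by (metis projection_def star_automorphism_simps(3,4))

text \<open>The index \<open>None\<close> carries the complement, so that the orthogonalization,
  which starts from a family with sum 1, applies to an arbitrary orthogonal family.\<close>

lemma partition_of_unity_option:
  fixes e :: "'g \<Rightarrow> 'a::unital_cstar_algebra"
  assumes "finite S" "orthogonal_projections S e"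
  defines "I \<equiv> insert None (Some ` S)" and "e' \<equiv> case_option (1 - sum e S) e"
  shows "orthogonal_projections I e'" "sum e' I = 1"
proof -
  show "orthogonal_projections I e'"
    using projection_sum[OF assms(1,2)] assms(2)
    by (auto simp: orthogonal_projections_def I_def e'_def projection_one_minus algebra_simps)
  show "sum e' I = 1"
    using assms(1) by (simp add: I_def e'_def sum.reindex)
qed

context
  fixes G :: "('g, 'm) monoid_scheme" (structure)
    and \<alpha> :: "'g \<Rightarrow> 'a \<Rightarrow> 'a::unital_cstar_algebra"
  assumes action: "finite_group_action G \<alpha>"
begin

lemma is_group: "group G" and finite_carrier: "finite (carrier G)"
  using action by (simp_all add: finite_group_action_def)

lemma action_automorphism: "g \<in> carrier G \<Longrightarrow> star_automorphism (\<alpha> g)"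
  using action by (auto simp: finite_group_action_def hom_def cstar_Aut_def)

lemma action_mult: "g \<in> carrier G \<Longrightarrow> h \<in> carrier G \<Longrightarrow> \<alpha> g (\<alpha> h x) = \<alpha> (g \<otimes> h) x"
  using action by (auto simp: finite_group_action_def hom_def cstar_Aut_def)

lemma bij_betw_left_mult: "g \<in> carrier G \<Longrightarrow> bij_betw (\<lambda>h. g \<otimes> h) (carrier G) (carrier G)"
  using is_group by (simp add: bij_betw_def group.inj_on_cmult group.surj_const_mult)

text \<open>The orbit of \<open>e \<one>\<close> together with an invariant projection near the
  complement is orthogonalized. \<open>N\<close> counts the group elements and the
  complement.\<close>

lemma equivariant_projections_near:
  fixes e :: "'g \<Rightarrow> 'a" and c :: real
  defines "N \<equiv> real (card (carrier G)) + 1"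
  assumes e: "orthogonal_projections (carrier G) e" and c: "0 < c" "c \<le> 1"
    and close: "\<And>g h. g \<in> carrier G \<Longrightarrow> h \<in> carrier G \<Longrightarrow>
      norm (\<alpha> g (e h) - e (g \<otimes> h)) \<le> c / (160 * N\<^sup>2)"
  obtains p where "orthogonal_projections (carrier G) p"
    "\<And>g h. g \<in> carrier G \<Longrightarrow> h \<in> carrier G \<Longrightarrow> \<alpha> g (p h) = p (g \<otimes> h)"
    "\<And>g. g \<in> carrier G \<Longrightarrow> norm (p g - e g) \<le> c"
    "norm (sum p (carrier G) - sum e (carrier G)) \<le> c"
proof -
  interpret group G by (rule is_group)
  define n where "n = real (card (carrier G))"
  \<comment> \<open>Chosen so that the orthogonalization error 8 N \<eta> equals c.\<close>
  define \<eta> where "\<eta> = c / (8 * N)"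
  \<comment> \<open>Chosen so that N \<delta> = \<eta> / 20: at most N errors add up in
    \<open>w\<close>, and making \<open>w\<close> a projection multiplies the total by 20.\<close>
  define \<delta> where "\<delta> = c / (160 * N\<^sup>2)"
  have "carrier G \<noteq> {}"
    using one_closed by blast
  then have n: "1 \<le> n" "N = n + 1"
    using finite_carrier by (auto simp: n_def N_def Suc_le_eq card_gt_0_iff)
  have "0 \<le> \<delta>"
    using c by (simp add: \<delta>_def)
  then have \<delta>: "\<delta> \<le> n * \<delta>"
    using mult_right_mono[OF n(1)] by simp
  have "n * \<delta> \<le> N * \<delta>"
    using \<open>0 \<le> \<delta>\<close> n(2) by (intro mult_right_mono) auto
  also have "\<dots> = \<eta> / 20"
    using n by (simp add: \<delta>_def \<eta>_def power2_eq_square)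
  finally have n\<delta>: "n * \<delta> \<le> \<eta> / 20" .
  have N\<eta>: "N * \<eta> = c / 8" and \<eta>: "\<eta> \<le> 1"
    using n c by (simp_all add: \<eta>_def divide_simps)
  define f where "f h = \<alpha> h (e \<one>)" for h
  have f_close: "norm (f h - e h) \<le> \<delta>" if "h \<in> carrier G" for h
    using close[OF that one_closed] that by (simp add: f_def \<delta>_def)
  have f_proj: "projection (f h)" if "h \<in> carrier G" for h
    using e projection_star_automorphism[OF action_automorphism[OF that]]
    by (simp add: f_def orthogonal_projections_def)
  have f_eq: "\<alpha> g (f h) = f (g \<otimes> h)" if "g \<in> carrier G" "h \<in> carrier G" for g h
    using that by (simp add: f_def action_mult)
  \<comment> \<open>Self-adjoint, invariant because left translation permutes the orbit, and close
    to the complement of the \<open>e h\<close>, but possibly not a projection.\<close>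
  define w where "w = 1 - sum f (carrier G)"
  have w_inv: "\<alpha> g w = w" if g: "g \<in> carrier G" for g
  proof -
    note add = additive_star_automorphism[OF action_automorphism[OF g]]
    have "\<alpha> g (sum f (carrier G)) = (\<Sum>h\<in>carrier G. f (g \<otimes> h))"
      using g by (simp add: Modules.additive.sum[OF add] f_eq)
    also have "\<dots> = sum f (carrier G)"
      using bij_betw_left_mult[OF g] by (rule sum.reindex_bij_betw)
    finally show ?thesis
      by (simp add: w_def Modules.additive.diff[OF add] star_automorphism_1[OF action_automorphism[OF g]])
  qed
  have "star w = w"
    using f_proj by (simp add: w_def star_diff star_sum projection_def)
  moreover have "projection (1 - sum e (carrier G))"
    by (intro projection_one_minus projection_sum finite_carrier e)
  moreover have "norm (w - (1 - sum e (carrier G))) \<le> \<eta> / 20"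
  proof -
    have "norm (w - (1 - sum e (carrier G))) = norm (\<Sum>h\<in>carrier G. f h - e h)"
      by (simp add: w_def sum_subtractf norm_minus_commute)
    also have "\<dots> \<le> n * \<delta>"
      unfolding n_def using f_close by (rule sum_norm_bound)
    finally show ?thesis
      using n\<delta> by simp
  qed
  moreover have "\<eta> / 20 \<le> 1 / 20"
    using \<eta> by simp
  ultimately obtain r where r: "projection r" "norm (r - (1 - sum e (carrier G))) \<le> 20 * (\<eta> / 20)"
    "\<And>\<phi>. star_automorphism \<phi> \<Longrightarrow> \<phi> w = w \<Longrightarrow> \<phi> r = r"
    by (rule projection_near_selfadjoint) (blast intro: that)
  define I where "I = insert None (Some ` carrier G)"
  define e' where "e' = case_option (1 - sum e (carrier G)) e"
  define q where "q = case_option r f"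
  define P where "P = lowdin I q"
  have card_I: "real (card I) = N"
    using finite_carrier by (simp add: I_def N_def card_image)
  have fin: "finite I" and ne: "I \<noteq> {}"
    using finite_carrier by (simp_all add: I_def)
  have e': "orthogonal_projections I e'" "sum e' I = 1"
    unfolding I_def e'_def using partition_of_unity_option[OF finite_carrier e] by simp_all
  have q: "projection (q i)" "norm (q i - e' i) \<le> \<eta>" if "i \<in> I" for i
    using that f_proj r(1,2) f_close n\<delta> \<delta> \<open>0 \<le> \<delta>\<close> by (fastforce simp: I_def q_def e'_def)+
  have small: "real (card I) * \<eta> \<le> 1 / 4"
    using N\<eta> c(2) by (simp add: card_I)
  note lowdin = fin ne e' q small
  have P: "orthogonal_projections I P" "sum P I = 1"
    unfolding P_def by (rule orthogonal_projections_lowdin[OF lowdin] sum_lowdin[OF lowdin]; assumption)+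
  have P_close: "norm (P i - e' i) \<le> c" if "i \<in> I" for i
    using lowdin_close[OF lowdin that] N\<eta> by (simp add: P_def card_I mult.assoc)
  have P_eq: "\<alpha> g (P (Some h)) = P (Some (g \<otimes> h))" if g: "g \<in> carrier G" and h: "h \<in> carrier G" for g h
  proof -
    \<comment> \<open>On indices \<open>g\<close> acts by left translation and fixes
      \<open>None\<close>, in accordance with the invariance of \<open>r\<close>.\<close>
    have "bij_betw (map_option (\<lambda>h. g \<otimes> h)) I I"
    proof (rule bij_betw_imageI)
      show "inj_on (map_option (\<lambda>h. g \<otimes> h)) I"
        using bij_betw_left_mult[OF g] by (auto simp: I_def bij_betw_def inj_on_def)
      have "map_option (\<lambda>h. g \<otimes> h) ` I = insert None (Some ` ((\<lambda>h. g \<otimes> h) ` carrier G))"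
        by (simp add: I_def image_image)
      then show "map_option (\<lambda>h. g \<otimes> h) ` I = I"
        using bij_betw_left_mult[OF g] by (simp add: I_def bij_betw_def)
    qed
    moreover have "\<alpha> g (q i) = q (map_option (\<lambda>h. g \<otimes> h) i)" if "i \<in> I" for i
      using that r(3)[OF action_automorphism[OF g] w_inv[OF g]] f_eq[OF g] by (auto simp: I_def q_def)
    ultimately have "\<alpha> g (lowdin I q (Some h)) = lowdin I q (map_option (\<lambda>h. g \<otimes> h) (Some h))"
      using h by (intro lowdin_equivariant[OF lowdin action_automorphism[OF g]]) (auto simp: I_def)
    then show ?thesis
      by (simp add: P_def)
  qed
  show thesis
  proof
    show "orthogonal_projections (carrier G) (\<lambda>g. P (Some g))"
      using P(1) by (auto simp: orthogonal_projections_def I_def)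
    show "norm (P (Some g) - e g) \<le> c" if "g \<in> carrier G" for g
      using P_close[of "Some g"] that by (simp add: I_def e'_def)
    \<comment> \<open>The sums are compared through their complements, so the error is the single
      one at \<open>None\<close> and does not grow with the order of the group.\<close>
    have "P None = 1 - (\<Sum>g\<in>carrier G. P (Some g))"
      using P(2) finite_carrier by (simp add: I_def sum.reindex algebra_simps)
    then show "norm ((\<Sum>g\<in>carrier G. P (Some g)) - sum e (carrier G)) \<le> c"
      using P_close[of None] by (simp add: I_def e'_def norm_minus_commute)
  qed (rule P_eq)
qed

end

section \<open>Transfer of the commutator and corner estimates, and the equivalence\<close>

lemma norm_commutator_le:
  fixes p e a :: "'a::real_normed_algebra"
  shows "norm (p * a - a * p) \<le> norm (e * a - a * e) + 2 * norm (p - e) * norm a"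
proof -
  have "p * a - a * p = (e * a - a * e) + ((p - e) * a - a * (p - e))"
    by (simp add: algebra_simps)
  then show ?thesis
    using norm_triangle_ineq[of "e * a - a * e" "(p - e) * a - a * (p - e)"]
      norm_triangle_ineq4[of "(p - e) * a" "a * (p - e)"]
      norm_mult_ineq[of "p - e" a] norm_mult_ineq[of a "p - e"]
    by (simp add: mult.commute)
qed

text \<open>All three factors are contractions, so replacing each outer factor costs
  \<open>norm (s - t)\<close>.\<close>

lemma norm_compression_diff_le:
  fixes s t x :: "'a::unital_cstar_algebra"
  assumes "projection s" "projection t" "norm x \<le> 1"
  shows "norm (t * x * t) - norm (s * x * s) \<le> 2 * norm (s - t)"
proof -
  note proj = assms(1,2)[THEN norm_projection_le]
  have "norm (t * x) \<le> 1"
    using norm_mult_ineq[of t x] mult_le_one[OF proj(2) norm_ge_zero assms(3)] by simp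
  then have "norm (t * x * t - s * x * s) \<le> 1 * norm (t - s) + 1 * norm (t * x - s * x)"
    using proj by (intro norm_mult_diff_le)
  moreover have "norm (t * x - s * x) \<le> 1 * norm (x - x) + 1 * norm (t - s)"
    using proj(2) assms(3) by (rule norm_mult_diff_le)
  ultimately show ?thesis
    using norm_triangle_ineq2[of "t * x * t" "s * x * s"] by (simp add: norm_minus_commute)
qed

theorem proposition5p27:
  fixes G :: "('g, 'm) monoid_scheme"
    and \<alpha> :: "'g \<Rightarrow> 'a \<Rightarrow> 'a::unital_cstar_algebra"
  assumes "infinite_dimensional TYPE('a)"
    and "simple_cstar TYPE('a)"
    and "separable TYPE('a)"
    and "finite_group_action G \<alpha>"
  shows "tracial_rokhlin_property G \<alpha> \<longleftrightarrow>
     (\<forall>(F :: 'a set) (\<epsilon> :: real) (x :: 'a).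
        finite F \<longrightarrow> \<epsilon> > 0 \<longrightarrow> positive_elem x \<longrightarrow> norm x = 1 \<longrightarrow>
        (\<exists>e :: 'g \<Rightarrow> 'a. orthogonal_projections (carrier G) e \<and>
           (\<forall>g\<in>carrier G. \<forall>h\<in>carrier G. \<alpha> g (e h) = e (g \<otimes>\<^bsub>G\<^esub> h)) \<and>
           (\<forall>g\<in>carrier G. \<forall>a\<in>F. norm (e g * a - a * e g) < \<epsilon>) \<and>
           (let s = \<Sum>g\<in>carrier G. e g in
              (\<exists>q\<in>hereditary_generated x. projection q \<and> murray_von_neumann_equiv (1 - s) q) \<and>
              norm (s * x * s) > 1 - \<epsilon>)))"
    (is "_ \<longleftrightarrow> ?exact")
proof
  assume exact: ?exact
  show "tracial_rokhlin_property G \<alpha>"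
    unfolding tracial_rokhlin_property_def
  proof (intro allI impI, goal_cases)
    case (1 F \<epsilon> x)
    from exact[rule_format, OF 1] show ?case
      by (elim ex_forward conj_forward) (use 1 in simp_all)
  qed
next
  assume trp: "tracial_rokhlin_property G \<alpha>"
  show ?exact
  proof (intro allI impI)
    fix F :: "'a set" and \<epsilon> :: real and x :: 'a
    assume F: "finite F" and \<epsilon>: "\<epsilon> > 0" and x: "positive_elem x" "norm x = 1"
    \<comment> \<open>The summand 1 keeps the bound at least 1, even for empty \<open>F\<close>, so
      that one \<open>c\<close> serves commutators and corner alike.\<close>
    define M where "M = (\<Sum>a\<in>F. norm a) + 1"
    have "1 \<le> M"
      by (simp add: M_def sum_nonneg)
    moreover have "norm a \<le> M" if "a \<in> F" for a
      using F member_le_sum[of a F norm] that by (simp add: M_def)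
    ultimately have M: "1 \<le> M" "\<And>a. a \<in> F \<Longrightarrow> norm a \<le> M"
      by blast+
    \<comment> \<open>The bound 1/2 gives c < 1, as the equivalence of close projections requires;
      the other bound keeps the perturbation of the commutators and of the corner within \<epsilon>
      / 2.\<close>
    define c where "c = min (1 / 2) (\<epsilon> / (4 * M))"
    have c: "0 < c" "c \<le> 1" "c < 1" "2 * c * M \<le> \<epsilon> / 2" "2 * c \<le> \<epsilon> / 2"
    proof -
      show "0 < c" "c \<le> 1" "c < 1"
        using \<epsilon> M(1) by (auto simp: c_def)
      have "c \<le> \<epsilon> / (4 * M)"
        by (simp add: c_def)
      then show le: "2 * c * M \<le> \<epsilon> / 2"
        using M(1) by (simp add: field_simps)
      have "2 * c * 1 \<le> 2 * c * M"
        using \<open>0 < c\<close> M(1) by (intro mult_left_mono) auto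
      with le show "2 * c \<le> \<epsilon> / 2"
        by simp
    qed
    define \<delta> where "\<delta> = c / (160 * (real (card (carrier G)) + 1)\<^sup>2)"
    have "0 < \<delta>"
      unfolding \<delta>_def using c(1) by (intro divide_pos_pos mult_pos_pos zero_less_power) auto
    \<comment> \<open>Here \<delta> controls the equivariance defect, while \<epsilon> / 2 leaves
      the other half of \<epsilon> for passing from \<open>e\<close> to \<open>p\<close>.\<close>
    then have "0 < min \<delta> (\<epsilon> / 2)"
      using \<epsilon> by simp
    from trp[unfolded tracial_rokhlin_property_def Let_def, rule_format, OF F this x] obtain e where
      e: "orthogonal_projections (carrier G) e"
      and eq: "\<forall>g\<in>carrier G. \<forall>h\<in>carrier G. norm (\<alpha> g (e h) - e (g \<otimes>\<^bsub>G\<^esub> h)) < min \<delta> (\<epsilon> / 2)"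
      and comm: "\<forall>g\<in>carrier G. \<forall>a\<in>F. norm (e g * a - a * e g) < min \<delta> (\<epsilon> / 2)"
      and mvn: "\<exists>q\<in>hereditary_generated x. projection q \<and>
        murray_von_neumann_equiv (1 - sum e (carrier G)) q"
      and big: "norm (sum e (carrier G) * x * sum e (carrier G)) > 1 - min \<delta> (\<epsilon> / 2)"
      by (elim exE conjE) (rule that)
    have near: "norm (\<alpha> g (e h) - e (g \<otimes>\<^bsub>G\<^esub> h)) \<le> c / (160 * (real (card (carrier G)) + 1)\<^sup>2)"
      if "g \<in> carrier G" "h \<in> carrier G" for g h
      using eq that by (fastforce simp: \<delta>_def)
    obtain p where
      p: "orthogonal_projections (carrier G) p"
      and p_eq: "\<And>g h. g \<in> carrier G \<Longrightarrow> h \<in> carrier G \<Longrightarrow> \<alpha> g (p h) = p (g \<otimes>\<^bsub>G\<^esub> h)"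
      and p_close: "\<And>g. g \<in> carrier G \<Longrightarrow> norm (p g - e g) \<le> c"
      and s_close: "norm (sum p (carrier G) - sum e (carrier G)) \<le> c"
      by (rule equivariant_projections_near[OF assms(4) e c(1,2)]) (use near in \<open>blast intro: that\<close>)+
    have fin: "finite (carrier G)"
      using assms(4) by (simp add: finite_group_action_def)
    note proj = projection_sum(1)[OF fin e] projection_sum(1)[OF fin p]
    have "norm (p g * a - a * p g) < \<epsilon>" if "g \<in> carrier G" "a \<in> F" for g a
    proof -
      have "2 * norm (p g - e g) * norm a \<le> 2 * c * M"
        using p_close[OF that(1)] M(2)[OF that(2)] c(1) by (intro mult_mono) auto
      moreover have "norm (e g * a - a * e g) < \<epsilon> / 2"
        using comm that by simp
      ultimately show ?thesis
        using norm_commutator_le[of "p g" a "e g"] c(4) by linarith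
    qed
    moreover have "\<exists>q\<in>hereditary_generated x. projection q \<and>
        murray_von_neumann_equiv (1 - sum p (carrier G)) q"
    proof -
      \<comment> \<open>The complements are at distance at most c < 1. By transitivity the same
        projection in the hereditary subalgebra serves for \<open>p\<close>.\<close>
      have "murray_von_neumann_equiv (1 - sum p (carrier G)) (1 - sum e (carrier G))"
        using s_close c(3) proj
        by (intro close_projections_equiv projection_one_minus) (simp_all add: norm_minus_commute)
      with mvn proj show ?thesis
        by (meson murray_von_neumann_equiv_trans projection_one_minus)
    qed
    moreover have "norm (sum p (carrier G) * x * sum p (carrier G)) > 1 - \<epsilon>"
      using norm_compression_diff_le[OF proj(2,1), of x] x(2) s_close big c(5) by auto
    ultimately show "\<exists>e :: 'g \<Rightarrow> 'a. orthogonal_projections (carrier G) e \<and>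
           (\<forall>g\<in>carrier G. \<forall>h\<in>carrier G. \<alpha> g (e h) = e (g \<otimes>\<^bsub>G\<^esub> h)) \<and>
           (\<forall>g\<in>carrier G. \<forall>a\<in>F. norm (e g * a - a * e g) < \<epsilon>) \<and>
           (let s = \<Sum>g\<in>carrier G. e g in
              (\<exists>q\<in>hereditary_generated x. projection q \<and> murray_von_neumann_equiv (1 - s) q) \<and>
              norm (s * x * s) > 1 - \<epsilon>)"
      using p p_eq by (auto simp: Let_def)
  qed
qed

end
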